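(* Let $K$ be a simplicial complex and let $n\ge 2$. For a vertex $v_0$ in $K$, define $i_j:K^{n-1}\to K^n$, for $j\in\{1,\dots,n\}$, by $i_j(\sigma_1,\dots,\sigma_{n-1})=(\sigma_1,\dots,\sigma_{j-1},v_0,\sigma_j,\dots,\sigma_{n-1})$. Then $\mathrm{scat}(K^{n-1})=\mathrm{SD}(i_1,\dots,i_n)$.
   Context: Simplicial complexes are abstract simplicial complexes. Two simplicial maps $\varphi,\psi:K\to L$ are contiguous if for every simplex $\{v_0,\dots,v_k\}$ of $K$ the set $\{\varphi(v_0),\dots,\varphi(v_k),\psi(v_0),\dots,\psi(v_k)\}$ is a simplex of $L$. They are in the same contiguity class, written $\varphi\sim\psi$, if there is a finite sequence of simplicial maps $K\to L$ from $\varphi$ to $\psi$ in which consecutive maps are contiguous. For simplicial maps $\varphi_1,\dots,\varphi_n:K\to K'$, the $n$-th contiguity distance $\mathrm{SD}(\varphi_1,\dots,\varphi_n)$ is the least integer $k\ge 0$ such that $K$ is covered by subcomplexes $K_0,\dots,K_k$ with $\varphi_1|_{K_j},\dots,\varphi_n|_{K_j}:K_j\to K'$ all in the same contiguity class for each $j=0,\dots,k$; it is $\infty$ if there is no such covering. $K^m$ denotes the $m$-fold categorical product: its vertex set is $V(K)^m$, where $V(K)$ is the vertex set of $K$, and a set of vertices is a simplex of $K^m$ if each of its $m$ coordinate projections is a simplex of $K$. A subcomplex $\Omega\subset K$ is categorical if the inclusion $\Omega\hookrightarrow K$ and a constant map $c_{v}:\Omega\to K$, where $v$ is some fixed vertex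 of $K$, are in the same contiguity class. The simplicial Lusternik-Schnirelmann category $\mathrm{scat}(K)$ is the least integer $k\ge 0$ such that $K$ is covered by categorical subcomplexes $\Omega_0,\dots,\Omega_k$. *)

theory Defs
  imports Main "HOL-Library.Extended_Nat"
begin

text \<open>An abstract simplicial complex is given by its set of (nonempty, finite) simplices.
  Infinite complexes and the empty complex (as a subcomplex) are allowed.\<close>

definition asc :: "'a set set \<Rightarrow> bool" where
  "asc K \<longleftrightarrow> (\<forall>\<sigma>\<in>K. finite \<sigma> \<and> \<sigma> \<noteq> {}) \<and> (\<forall>\<sigma>\<in>K. \<forall>\<tau>. \<tau> \<subseteq> \<sigma> \<longrightarrow> \<tau> \<noteq> {} \<longrightarrow> \<tau> \<in> K)"

definition verts :: "'a set set \<Rightarrow> 'a set" where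
  "verts K = \<Union>K"

definition subcomplex :: "'a set set \<Rightarrow> 'a set set \<Rightarrow> bool" where
  "subcomplex L K \<longleftrightarrow> asc L \<and> L \<subseteq> K"

text \<open>Simplicial maps are total functions of which only the values on the vertices of the
  domain matter; the restriction to a subcomplex is therefore the same function.\<close>

definition simplicial_map :: "'a set set \<Rightarrow> 'b set set \<Rightarrow> ('a \<Rightarrow> 'b) \<Rightarrow> bool" where
  "simplicial_map K L \<phi> \<longleftrightarrow> (\<forall>\<sigma>\<in>K. \<phi> ` \<sigma> \<in> L)"

definition contiguous :: "'a set set \<Rightarrow> 'b set set \<Rightarrow> ('a \<Rightarrow> 'b) \<Rightarrow> ('a \<Rightarrow> 'b) \<Rightarrow> bool" where
  "contiguous K L \<phi> \<psi> \<longleftrightarrow>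
     simplicial_map K L \<phi> \<and> simplicial_map K L \<psi> \<and> (\<forall>\<sigma>\<in>K. \<phi> ` \<sigma> \<union> \<psi> ` \<sigma> \<in> L)"

definition same_contiguity_class ::
    "'a set set \<Rightarrow> 'b set set \<Rightarrow> ('a \<Rightarrow> 'b) \<Rightarrow> ('a \<Rightarrow> 'b) \<Rightarrow> bool" where
  "same_contiguity_class K L \<phi> \<psi> \<longleftrightarrow>
     simplicial_map K L \<phi> \<and> simplicial_map K L \<psi> \<and> (contiguous K L)\<^sup>*\<^sup>* \<phi> \<psi>"

text \<open>The infimum over the empty set in \<^typ>\<open>enat\<close> is \<open>\<infinity>\<close>.\<close>

definition SD :: "'a set set \<Rightarrow> 'b set set \<Rightarrow> ('a \<Rightarrow> 'b) list \<Rightarrow> enat" where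
  "SD K L \<phi>s = Inf {enat k | k. \<exists>Ks :: nat \<Rightarrow> 'a set set.
     (\<forall>j\<le>k. subcomplex (Ks j) K) \<and> K = (\<Union>j\<le>k. Ks j) \<and>
     (\<forall>j\<le>k. \<forall>\<phi>\<in>set \<phi>s. \<forall>\<psi>\<in>set \<phi>s. same_contiguity_class (Ks j) L \<phi> \<psi>)}"

text \<open>Vertices of the \<open>m\<close>-fold categorical product are represented by lists of length \<open>m\<close>.
  A set of vertices whose projections are all finite is finite if \<open>m \<ge> 1\<close>.\<close>

definition cat_power :: "'a set set \<Rightarrow> nat \<Rightarrow> 'a list set set" where
  "cat_power K m = {S. S \<noteq> {} \<and> S \<subseteq> {xs. length xs = m \<and> set xs \<subseteq> verts K} \<and>
     (\<forall>i<m. (\<lambda>xs. xs ! i) ` S \<in> K)}"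

text \<open>The constant map in the definition of a categorical subcomplex takes its value in a vertex
  \<open>v\<close> of \<open>K\<close> that is fixed once and for all, i.e. it is the same for all members of a covering.
  The lemma \<open>scat_base_indep\<close> below shows that \<open>scat\<close> does not depend on this choice.
  (If \<open>v\<close> were allowed to vary with the subcomplex, nothing would change for
  connected \<open>K\<close>, see \<open>categorical_base_indep\<close>.)\<close>

definition categorical :: "'a set set \<Rightarrow> 'a \<Rightarrow> 'a set set \<Rightarrow> bool" where
  "categorical K v \<Omega> \<longleftrightarrow> v \<in> verts K \<and> subcomplex \<Omega> K \<and>
     same_contiguity_class \<Omega> K (\<lambda>x. x) (\<lambda>_. v)"

definition scat :: "'a set set \<Rightarrow> 'a \<Rightarrow> enat" where
  "scat K v = Inf {enat k | k. \<exists>\<Omega> :: nat \<Rightarrow> 'a set set.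
     (\<forall>j\<le>k. categorical K v (\<Omega> j)) \<and> K = (\<Union>j\<le>k. \<Omega> j)}"

text \<open>The map \<open>(\<sigma>\<^sub>1, \<dots>, \<sigma>\<^sub>n\<^sub>-\<^sub>1) \<mapsto> (\<sigma>\<^sub>1, \<dots>, \<sigma>\<^sub>j\<^sub>-\<^sub>1, v, \<sigma>\<^sub>j, \<dots>, \<sigma>\<^sub>n\<^sub>-\<^sub>1)\<close>, with \<open>j\<close> counted from 1.\<close>

definition insert_at :: "'a \<Rightarrow> nat \<Rightarrow> 'a list \<Rightarrow> 'a list" where
  "insert_at v j xs = take (j - 1) xs @ v # drop (j - 1) xs"


lemma asc_subset:
  assumes "asc K" "\<sigma> \<in> K" "\<tau> \<subseteq> \<sigma>" "\<tau> \<noteq> {}"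
  shows "\<tau> \<in> K"
proof -
  have "\<forall>\<sigma>\<in>K. \<forall>\<tau>. \<tau> \<subseteq> \<sigma> \<longrightarrow> \<tau> \<noteq> {} \<longrightarrow> \<tau> \<in> K"
    using assms(1) unfolding asc_def by (rule conjunct2)
  then have "\<forall>\<tau>. \<tau> \<subseteq> \<sigma> \<longrightarrow> \<tau> \<noteq> {} \<longrightarrow> \<tau> \<in> K" using assms(2) by (rule bspec)
  then show ?thesis using assms(3,4) by simp
qed

lemma asc_simplex:
  assumes "asc K" "\<sigma> \<in> K"
  shows "finite \<sigma> \<and> \<sigma> \<noteq> {}"
proof -
  have "\<forall>\<sigma>\<in>K. finite \<sigma> \<and> \<sigma> \<noteq> {}" using assms(1) unfolding asc_def by (rule conjunct1)
  then show ?thesis using assms(2) by (rule bspec)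
qed

lemma singleton_in_asc:
  assumes "asc K" "v \<in> verts K"
  shows "{v} \<in> K"
proof -
  obtain \<sigma> where \<sigma>: "\<sigma> \<in> K" "v \<in> \<sigma>" using assms(2) by (auto simp: verts_def)
  then show ?thesis using asc_subset[OF assms(1) \<sigma>(1), of "{v}"] by simp
qed

lemma verts_cat_power:
  assumes "asc K"
  shows "verts (cat_power K m) = {xs. length xs = m \<and> set xs \<subseteq> verts K}"
proof
  show "{xs. length xs = m \<and> set xs \<subseteq> verts K} \<subseteq> verts (cat_power K m)"
  proof
    fix xs assume xs: "xs \<in> {xs. length xs = m \<and> set xs \<subseteq> verts K}"
    have "{xs ! i} \<in> K" if "i < m" for i
    proof -
      have "xs ! i \<in> verts K" using xs that nth_mem[of i xs] by (simp add: subset_iff)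
      then show ?thesis by (rule singleton_in_asc[OF assms])
    qed
    then have "{xs} \<in> cat_power K m" using xs by (simp add: cat_power_def)
    then show "xs \<in> verts (cat_power K m)" unfolding verts_def by blast
  qed
  show "verts (cat_power K m) \<subseteq> {xs. length xs = m \<and> set xs \<subseteq> verts K}"
  proof
    fix xs assume "xs \<in> verts (cat_power K m)"
    then obtain S where S: "S \<in> cat_power K m" "xs \<in> S" unfolding verts_def by blast
    then have "S \<subseteq> {xs. length xs = m \<and> set xs \<subseteq> verts K}" by (simp add: cat_power_def)
    then show "xs \<in> {xs. length xs = m \<and> set xs \<subseteq> verts K}" using S(2) by (rule subsetD)
  qed
qed

lemma asc_cat_power:
  assumes "asc K" "m \<ge> 1"
  shows "asc (cat_power K m)"
  unfolding asc_def
proof (intro conjI ballI allI impI)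
  fix S assume S: "S \<in> cat_power K m"
  let ?B = "\<Union>i<m. (\<lambda>xs. xs ! i) ` S"
  have pr: "(\<lambda>xs. xs ! i) ` S \<in> K" if "i < m" for i
    using S that by (simp add: cat_power_def)
  have "finite ((\<lambda>xs. xs ! i) ` S)" if "i < m" for i
    using asc_simplex[OF assms(1) pr[OF that]] by simp
  then have "finite ?B" by simp
  then have fin: "finite {xs. set xs \<subseteq> ?B \<and> length xs = m}" by (rule finite_lists_length_eq)
  have "S \<subseteq> {xs. set xs \<subseteq> ?B \<and> length xs = m}"
  proof
    fix xs assume xs: "xs \<in> S"
    then have l: "length xs = m" using S by (auto simp: cat_power_def)
    then have "set xs \<subseteq> ?B" using xs by (auto simp: set_conv_nth)
    then show "xs \<in> {xs. set xs \<subseteq> ?B \<and> length xs = m}" using l by simp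
  qed
  then show "finite S" using fin by (rule finite_subset)
  show "S \<noteq> {}" using S by (simp add: cat_power_def)
  fix T assume T: "T \<subseteq> S" "T \<noteq> {}"
  have "(\<lambda>xs. xs ! i) ` T \<in> K" if "i < m" for i
  proof -
    have "(\<lambda>xs. xs ! i) ` T \<subseteq> (\<lambda>xs. xs ! i) ` S" "(\<lambda>xs. xs ! i) ` T \<noteq> {}"
      using T by auto
    then show ?thesis by (rule asc_subset[OF assms(1) pr[OF that]])
  qed
  moreover have "T \<subseteq> {xs. length xs = m \<and> set xs \<subseteq> verts K}"
    using S T(1) unfolding cat_power_def by blast
  ultimately show "T \<in> cat_power K m" using T(2) by (simp add: cat_power_def)
qed

lemma simplicial_map_insert_at:
  assumes "asc K" "v \<in> verts K" "1 \<le> j" "j \<le> n" "n \<ge> 2"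
  shows "simplicial_map (cat_power K (n - 1)) (cat_power K n) (insert_at v j)"
  unfolding simplicial_map_def
proof
  fix S assume S: "S \<in> cat_power K (n - 1)"
  have v: "{v} \<in> K" by (rule singleton_in_asc[OF assms(1,2)])
  have nth: "insert_at v j xs ! i =
      (if i < j - 1 then xs ! i else if i = j - 1 then v else xs ! (i - 1))"
    if "xs \<in> S" "i < n" for xs i
  proof -
    have "length xs = n - 1" using S that by (auto simp: cat_power_def)
    then show ?thesis using assms that by (auto simp: insert_at_def nth_append nth_Cons' min_def)
  qed
  have pr': "(\<lambda>xs. xs ! i) ` insert_at v j ` S \<in> K" if i: "i < n" for i
  proof -
    have ne: "S \<noteq> {}" and pr: "\<And>i. i < n - 1 \<Longrightarrow> (\<lambda>xs. xs ! i) ` S \<in> K"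
      using S by (auto simp: cat_power_def)
    have "(\<lambda>xs. xs ! i) ` insert_at v j ` S = (\<lambda>xs. insert_at v j xs ! i) ` S"
      by (simp add: image_image)
    also have "\<dots> = (\<lambda>xs. if i < j - 1 then xs ! i else if i = j - 1 then v else xs ! (i - 1)) ` S"
      using nth i by (intro image_cong) auto
    finally show ?thesis using ne v pr[of i] pr[of "i - 1"] i assms
      by (auto split: if_splits simp: image_constant_conv)
  qed
  have "insert_at v j xs \<in> {xs. length xs = n \<and> set xs \<subseteq> verts K}" if "xs \<in> S" for xs
    using S that assms by (auto simp: cat_power_def insert_at_def dest!: in_set_takeD in_set_dropD)
  then have "insert_at v j ` S \<subseteq> {xs. length xs = n \<and> set xs \<subseteq> verts K}" by blast
  moreover have "insert_at v j ` S \<noteq> {}" using S by (simp add: cat_power_def)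
  ultimately show "insert_at v j ` S \<in> cat_power K n"
    using pr' unfolding cat_power_def by blast
qed

lemma contiguous_const:
  assumes "asc \<Omega>" "asc K" "{u, v} \<in> K"
  shows "contiguous \<Omega> K (\<lambda>_. u) (\<lambda>_. v)"
proof -
  have "{u} \<in> K" "{v} \<in> K"
    by (rule asc_subset[OF assms(2,3)]; simp)+
  moreover have "(\<lambda>_. u) ` \<sigma> = {u}" "(\<lambda>_. v) ` \<sigma> = {v}" if "\<sigma> \<in> \<Omega>" for \<sigma>
    using asc_simplex[OF assms(1) that] by auto
  ultimately show ?thesis using assms(3) by (simp add: contiguous_def simplicial_map_def insert_commute)
qed

lemma categorical_base_change:
  assumes "asc K" "(\<lambda>x y. {x, y} \<in> K)\<^sup>*\<^sup>* v w" "w \<in> verts K" "categorical K v \<Omega>"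
  shows "categorical K w \<Omega>"
proof -
  have \<Omega>: "asc \<Omega>" using assms(4) by (simp add: categorical_def subcomplex_def)
  have "(contiguous \<Omega> K)\<^sup>*\<^sup>* (\<lambda>_. v) (\<lambda>_. w)"
    using assms(2)
  proof induction
    case (step y z)
    have "contiguous \<Omega> K (\<lambda>_. y) (\<lambda>_. z)"
      using step.hyps(2) by (intro contiguous_const \<Omega> assms(1))
    then show ?case by (rule rtranclp.rtrancl_into_rtrancl[OF step.IH])
  qed simp
  moreover have "simplicial_map \<Omega> K (\<lambda>_. w)"
  proof -
    have "{w} \<in> K" by (rule singleton_in_asc[OF assms(1,3)])
    then show ?thesis using contiguous_const[OF \<Omega> assms(1), of w w] by (simp add: contiguous_def)
  qed
  ultimately show ?thesis using assms(3,4)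
    unfolding categorical_def same_contiguity_class_def by (blast intro: rtranclp_trans)
qed

lemma categorical_base_indep:
  assumes "asc K" "\<forall>x\<in>verts K. \<forall>y\<in>verts K. (\<lambda>x y. {x, y} \<in> K)\<^sup>*\<^sup>* x y"
    and "v \<in> verts K" "w \<in> verts K"
  shows "categorical K v \<Omega> \<longleftrightarrow> categorical K w \<Omega>"
proof
  have p: "(\<lambda>x y. {x, y} \<in> K)\<^sup>*\<^sup>* v w" "(\<lambda>x y. {x, y} \<in> K)\<^sup>*\<^sup>* w v"
    using assms(2-4) by simp_all
  show "categorical K v \<Omega> \<Longrightarrow> categorical K w \<Omega>"
    by (rule categorical_base_change[OF assms(1) p(1) assms(4)])
  show "categorical K w \<Omega> \<Longrightarrow> categorical K v \<Omega>"
    by (rule categorical_base_change[OF assms(1) p(2) assms(3)])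
qed

lemma contiguity_class_edge_path:
  assumes "(contiguous K L)\<^sup>*\<^sup>* \<phi> \<psi>" "{x} \<in> K"
  shows "(\<lambda>x y. {x, y} \<in> L)\<^sup>*\<^sup>* (\<phi> x) (\<psi> x)"
  using assms(1)
proof induction
  case (step f g)
  have "f ` {x} \<union> g ` {x} \<in> L" using step.hyps(2) assms(2) by (simp only: contiguous_def)
  then have "{f x, g x} \<in> L" by (simp add: insert_commute)
  then show ?case by (rule rtranclp.rtrancl_into_rtrancl[OF step.IH])
qed simp

lemma scat_base_indep:
  assumes "asc K" "v \<in> verts K" "w \<in> verts K"
  shows "scat K v = scat K w"
proof -
  have main: "\<forall>j\<le>k. categorical K w (\<Omega> j)"
    if w: "w \<in> verts K" and cat: "\<forall>j\<le>k. categorical K v (\<Omega> j)" and cov: "K = (\<Union>j\<le>k. \<Omega> j)"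
      for v w and k :: nat and \<Omega>
  proof -
    have "{w} \<in> K" by (rule singleton_in_asc[OF assms(1) w])
    then obtain j where j: "j \<le> k" "{w} \<in> \<Omega> j" using cov by blast
    have "(contiguous (\<Omega> j) K)\<^sup>*\<^sup>* (\<lambda>x. x) (\<lambda>_. v)"
      using cat j unfolding categorical_def same_contiguity_class_def by blast
    then have "(\<lambda>x y. {x, y} \<in> K)\<^sup>*\<^sup>* w v"
      using contiguity_class_edge_path[of "\<Omega> j" K "\<lambda>x. x" "\<lambda>_. v" w] j by simp
    then have "(\<lambda>x y. {x, y} \<in> K)\<^sup>*\<^sup>* v w"
    proof -
      have "symp (\<lambda>x y. {x, y} \<in> K)" by (auto intro: sympI simp: insert_commute)
      then have "symp (\<lambda>x y. {x, y} \<in> K)\<^sup>*\<^sup>*" by (rule symp_rtranclp)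
      then show ?thesis using \<open>(\<lambda>x y. {x, y} \<in> K)\<^sup>*\<^sup>* w v\<close> by (rule sympD)
    qed
    then show ?thesis using categorical_base_change[OF assms(1) _ w] cat by blast
  qed
  have "(\<exists>\<Omega>. (\<forall>j\<le>k. categorical K v (\<Omega> j)) \<and> K = (\<Union>j\<le>k. \<Omega> j)) \<longleftrightarrow>
        (\<exists>\<Omega>. (\<forall>j\<le>k. categorical K w (\<Omega> j)) \<and> K = (\<Union>j\<le>k. \<Omega> j))" for k :: nat
  proof
    show "\<exists>\<Omega>. (\<forall>j\<le>k. categorical K v (\<Omega> j)) \<and> K = (\<Union>j\<le>k. \<Omega> j) \<Longrightarrow>
        \<exists>\<Omega>. (\<forall>j\<le>k. categorical K w (\<Omega> j)) \<and> K = (\<Union>j\<le>k. \<Omega> j)"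
      using main[OF assms(3)] by (elim exE conjE) (intro exI conjI; assumption)
    show "\<exists>\<Omega>. (\<forall>j\<le>k. categorical K w (\<Omega> j)) \<and> K = (\<Union>j\<le>k. \<Omega> j) \<Longrightarrow>
        \<exists>\<Omega>. (\<forall>j\<le>k. categorical K v (\<Omega> j)) \<and> K = (\<Union>j\<le>k. \<Omega> j)"
      using main[OF assms(2)] by (elim exE conjE) (intro exI conjI; assumption)
  qed
  then show ?thesis by (simp add: scat_def)
qed

end

theory Submission
  imports Defs
begin

text \<open>Write \<open>m = n - 1\<close> and \<open>P = K\<^sup>m\<close>. The theorem holds subcomplex by subcomplex: a subcomplex
  \<open>\<Omega>\<close> of \<open>P\<close> is categorical if and only if the restrictions to \<open>\<Omega>\<close> of the maps
  \<open>i\<^sub>1, \<dots>, i\<^sub>n\<close> lie in one contiguity class (\<open>categorical_iff_insert_at_same_class\<close>), so that the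
  coverings admitted on the two sides are the same. The base vertex of \<open>P\<close> is taken to be the
  diagonal vertex \<open>(v\<^sub>0, \<dots>, v\<^sub>0)\<close>, since \<open>scat\<close> does not depend on it.

  If the inclusion of \<open>\<Omega>\<close> is in the class of the constant map at \<open>(v\<^sub>0, \<dots>, v\<^sub>0)\<close>, then composing
  with any \<open>i\<^sub>j\<close> shows that \<open>i\<^sub>j\<close> restricted to \<open>\<Omega>\<close> is in the class of the constant map at the
  diagonal vertex of \<open>K\<^sup>n\<close>, and that map is the same for all \<open>j\<close>.

  Conversely, the \<open>l\<close>-th coordinate of \<open>i\<^sub>l\<close> is constantly \<open>v\<^sub>0\<close>, while the \<open>l\<close>-th coordinate of
  \<open>i\<^sub>l\<^sub>+\<^sub>1\<close> is the \<open>l\<close>-th projection of \<open>P\<close>. Projecting \<open>i\<^sub>l \<sim> i\<^sub>l\<^sub>+\<^sub>1\<close> to this coordinate therefore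
  contracts the \<open>l\<close>-th projection on \<open>\<Omega>\<close> to \<open>v\<^sub>0\<close>. Contiguity classes in a categorical product can
  be treated one coordinate at a time (\<open>same_contiguity_class_tuple\<close>), so these contractions
  together contract the inclusion of \<open>\<Omega>\<close> to the diagonal vertex.\<close>

section \<open>Contiguity classes\<close>

lemma contiguous_iff:
  assumes "asc K" "asc L"
  shows "contiguous K L f g \<longleftrightarrow> (\<forall>\<sigma>\<in>K. f ` \<sigma> \<union> g ` \<sigma> \<in> L)"
proof
  assume un: "\<forall>\<sigma>\<in>K. f ` \<sigma> \<union> g ` \<sigma> \<in> L"
  have "f ` \<sigma> \<in> L \<and> g ` \<sigma> \<in> L" if "\<sigma> \<in> K" for \<sigma>
    using asc_subset[OF assms(2), of "f ` \<sigma> \<union> g ` \<sigma>"] un that asc_simplex[OF assms(1) that]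
    by simp
  then show "contiguous K L f g"
    using un by (simp add: contiguous_def simplicial_map_def)
qed (simp add: contiguous_def)

lemma same_contiguity_class_sym:
  assumes "same_contiguity_class K L f g"
  shows "same_contiguity_class K L g f"
proof -
  have "symp (contiguous K L)" by (auto intro!: sympI simp: contiguous_def Un_commute)
  then have "symp (contiguous K L)\<^sup>*\<^sup>*" by (rule symp_rtranclp)
  then show ?thesis
    using assms by (auto simp: same_contiguity_class_def dest: sympD)
qed

lemma same_contiguity_class_trans:
  assumes "same_contiguity_class K L f g" "same_contiguity_class K L g h"
  shows "same_contiguity_class K L f h"
  using assms by (auto simp: same_contiguity_class_def)

lemma contiguous_imp_same_contiguity_class:
  "contiguous K L f g \<Longrightarrow> same_contiguity_class K L f g"
  by (auto simp: same_contiguity_class_def contiguous_def)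

lemma contiguous_if_eq_on_verts:
  assumes "simplicial_map K L f" and eq: "\<And>x. x \<in> verts K \<Longrightarrow> f x = g x"
  shows "contiguous K L f g"
proof -
  have "g ` \<sigma> = f ` \<sigma>" if "\<sigma> \<in> K" for \<sigma>
    using that by (intro image_cong refl eq[symmetric]) (auto simp: verts_def)
  then show ?thesis using assms(1) by (simp add: contiguous_def simplicial_map_def)
qed

text \<open>Total functions that agree on the vertices of \<open>K\<close> represent the same simplicial map; this
  is what allows their values elsewhere to be ignored.\<close>

lemma same_contiguity_class_cong:
  assumes cls: "same_contiguity_class K L f g"
    and "\<And>x. x \<in> verts K \<Longrightarrow> f x = f' x" "\<And>x. x \<in> verts K \<Longrightarrow> g x = g' x"
  shows "same_contiguity_class K L f' g'"
proof -
  have "same_contiguity_class K L f f'" "same_contiguity_class K L g g'"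
    using cls
    by (intro contiguous_imp_same_contiguity_class contiguous_if_eq_on_verts assms(2,3);
        simp add: same_contiguity_class_def)+
  then show ?thesis
    using cls by (blast intro: same_contiguity_class_sym same_contiguity_class_trans)
qed

lemma same_contiguity_class_comp:
  assumes "same_contiguity_class K L f g" and h: "simplicial_map L M h"
  shows "same_contiguity_class K M (\<lambda>x. h (f x)) (\<lambda>x. h (g x))"
proof -
  have im: "(\<lambda>x. h (p x)) ` \<sigma> = h ` (p ` \<sigma>)" for p :: "'a \<Rightarrow> 'b" and \<sigma>
    by (simp add: image_image)
  have step: "contiguous K M (\<lambda>x. h (p x)) (\<lambda>x. h (q x))" if "contiguous K L p q" for p q
    using that h unfolding contiguous_def simplicial_map_def im image_Un[symmetric] by blast
  have "(contiguous K L)\<^sup>*\<^sup>* f g"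
    using assms(1) by (simp add: same_contiguity_class_def)
  then have "(contiguous K M)\<^sup>*\<^sup>* (\<lambda>x. h (f x)) (\<lambda>x. h (g x))"
    by induction (auto intro: rtranclp.rtrancl_into_rtrancl step)
  moreover have "simplicial_map K M (\<lambda>x. h (f x))" "simplicial_map K M (\<lambda>x. h (g x))"
    using assms unfolding same_contiguity_class_def simplicial_map_def im by blast+
  ultimately show ?thesis by (simp add: same_contiguity_class_def)
qed

section \<open>Maps into a categorical power\<close>

lemma simplicial_map_nth:
  assumes "l < m"
  shows "simplicial_map (cat_power K m) K (\<lambda>xs. xs ! l)"
  using assms by (simp add: simplicial_map_def cat_power_def)

definition tuple_map :: "nat \<Rightarrow> (nat \<Rightarrow> 'a \<Rightarrow> 'b) \<Rightarrow> 'a \<Rightarrow> 'b list" where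
  "tuple_map m f x = map (\<lambda>l. f l x) [0..<m]"

lemma contiguous_tuple_map:
  assumes "asc \<Omega>" "asc K" "m \<ge> 1" and cont: "\<And>l. l < m \<Longrightarrow> contiguous \<Omega> K (f l) (g l)"
  shows "contiguous \<Omega> (cat_power K m) (tuple_map m f) (tuple_map m g)"
  unfolding contiguous_iff[OF assms(1) asc_cat_power[OF assms(2,3)]]
proof
  fix \<sigma> assume \<sigma>: "\<sigma> \<in> \<Omega>"
  let ?S = "tuple_map m f ` \<sigma> \<union> tuple_map m g ` \<sigma>"
  have un: "f l ` \<sigma> \<union> g l ` \<sigma> \<in> K" if "l < m" for l
    using cont[OF that] \<sigma> by (simp add: contiguous_def)
  then have "f l x \<in> verts K" "g l x \<in> verts K" if "l < m" "x \<in> \<sigma>" for l x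
    using that unfolding verts_def by blast+
  then have "?S \<subseteq> {xs. length xs = m \<and> set xs \<subseteq> verts K}"
    by (auto simp: tuple_map_def)
  moreover have "?S \<noteq> {}" using asc_simplex[OF assms(1) \<sigma>] by simp
  moreover have "(\<lambda>xs. xs ! l) ` ?S \<in> K" if "l < m" for l
  proof -
    have "(\<lambda>xs. xs ! l) ` ?S = f l ` \<sigma> \<union> g l ` \<sigma>"
      using that by (simp add: image_Un image_image tuple_map_def)
    then show ?thesis using un[OF that] by simp
  qed
  ultimately show "?S \<in> cat_power K m" by (simp add: cat_power_def)
qed

text \<open>The sequences of contiguous maps connecting the coordinates may have different lengths, so
  they are run one after the other: while one coordinate moves, the others stay fixed, and a
  simplicial map is contiguous to itself.\<close>

lemma same_contiguity_class_tuple: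
  assumes "asc \<Omega>" "asc K" "m \<ge> 1"
    and cls: "\<And>l. l < m \<Longrightarrow> same_contiguity_class \<Omega> K (f l) (g l)"
  shows "same_contiguity_class \<Omega> (cat_power K m) (tuple_map m f) (tuple_map m g)"
proof -
  let ?sim = "same_contiguity_class \<Omega> (cat_power K m)"
  have one: "?sim (tuple_map m (p(k := a))) (tuple_map m (p(k := b)))"
    if p: "\<And>l. l < m \<Longrightarrow> simplicial_map \<Omega> K (p l)"
      and ab: "same_contiguity_class \<Omega> K a b" for p k a b
  proof -
    have step: "?sim (tuple_map m (p(k := c))) (tuple_map m (p(k := d)))"
      if "contiguous \<Omega> K c d" for c d
      using that p
      by (intro contiguous_imp_same_contiguity_class contiguous_tuple_map assms(1-3))
        (auto simp: contiguous_if_eq_on_verts)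
    have "(contiguous \<Omega> K)\<^sup>*\<^sup>* a b" "contiguous \<Omega> K a a"
      using ab by (auto simp: same_contiguity_class_def intro: contiguous_if_eq_on_verts)
    then show ?thesis
      by induction (blast intro: step same_contiguity_class_trans)+
  qed
  have "?sim (tuple_map m f) (tuple_map m (\<lambda>l. if l < k then g l else f l))" if "k \<le> m" for k
    using that
  proof (induction k)
    case 0
    have "contiguous \<Omega> (cat_power K m) (tuple_map m f) (tuple_map m f)"
      using cls
      by (intro contiguous_tuple_map assms(1-3) contiguous_if_eq_on_verts)
        (auto simp: same_contiguity_class_def)
    then show ?case by (simp add: contiguous_imp_same_contiguity_class)
  next
    case (Suc k)
    let ?p = "\<lambda>l. if l < k then g l else f l"
    have "?sim (tuple_map m (?p(k := f k))) (tuple_map m (?p(k := g k)))"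
      using Suc.prems cls by (intro one) (auto simp: same_contiguity_class_def)
    moreover have "?p(k := f k) = ?p" "?p(k := g k) = (\<lambda>l. if l < Suc k then g l else f l)"
      by (auto simp: less_Suc_eq)
    ultimately show ?case
      using Suc by (auto intro: same_contiguity_class_trans)
  qed
  from this[of m] have "?sim (tuple_map m f) (tuple_map m (\<lambda>l. if l < m then g l else f l))"
    by simp
  moreover have "tuple_map m (\<lambda>l. if l < m then g l else f l) = tuple_map m g"
    by (rule ext) (simp add: tuple_map_def)
  ultimately show ?thesis by simp
qed

section \<open>Inserting the base vertex\<close>

lemma insert_at_nth_inserted:
  "l \<le> length xs \<Longrightarrow> insert_at v (l + 1) xs ! l = v"
  by (simp add: insert_at_def nth_append)

lemma insert_at_nth_before:
  "l < length xs \<Longrightarrow> insert_at v (l + 2) xs ! l = xs ! l"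
  by (simp add: insert_at_def nth_append)

lemma insert_at_replicate:
  assumes "1 \<le> j" "j \<le> Suc m"
  shows "insert_at v j (replicate m v) = replicate (Suc m) v"
  using assms
  by (intro nth_equalityI) (auto simp: insert_at_def nth_append nth_Cons')

text \<open>Because this equivalence concerns a single subcomplex, \<open>scat\<close> and \<open>SD\<close> turn out to be
  infima over the same coverings. The \<open>n - 1\<close> consecutive pairs of maps match the \<open>n - 1\<close>
  coordinates that have to be contracted.\<close>

lemma categorical_iff_insert_at_same_class:
  assumes "asc K" "n \<ge> 2" "v \<in> verts K"
  shows "categorical (cat_power K (n - 1)) (replicate (n - 1) v) \<Omega> \<longleftrightarrow>
    subcomplex \<Omega> (cat_power K (n - 1)) \<and>
    (\<forall>j\<in>{1..n}. \<forall>k\<in>{1..n}.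
      same_contiguity_class \<Omega> (cat_power K n) (insert_at v j) (insert_at v k))"
    (is "?cat \<longleftrightarrow> ?sub \<and> ?same")
proof
  assume ?cat
  then have \<Omega>: ?sub
    and contr: "same_contiguity_class \<Omega> (cat_power K (n - 1)) (\<lambda>x. x) (\<lambda>_. replicate (n - 1) v)"
    by (auto simp: categorical_def)
  have "same_contiguity_class \<Omega> (cat_power K n) (insert_at v j) (\<lambda>_. replicate n v)"
    if "j \<in> {1..n}" for j
  proof -
    have "simplicial_map (cat_power K (n - 1)) (cat_power K n) (insert_at v j)"
      using that assms by (intro simplicial_map_insert_at) auto
    from same_contiguity_class_comp[OF contr this] show ?thesis
      using that assms(2) insert_at_replicate[of j "n - 1" v] by simp
  qed
  then have ?same
    by (blast intro: same_contiguity_class_sym same_contiguity_class_trans)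
  with \<Omega> show "?sub \<and> ?same" by blast
next
  assume R: "?sub \<and> ?same"
  then have \<Omega>: "asc \<Omega>" "\<Omega> \<subseteq> cat_power K (n - 1)" by (auto simp: subcomplex_def)
  have len: "length x = n - 1" if "x \<in> verts \<Omega>" for x
    using that \<Omega>(2) by (auto simp: verts_def cat_power_def)
  \<comment> \<open>Coordinates are counted from 0 but the maps \<open>i\<^sub>j\<close> from 1: coordinate \<open>l\<close> is the inserted
    vertex under \<open>i\<^sub>l\<^sub>+\<^sub>1\<close> and is still the original one under \<open>i\<^sub>l\<^sub>+\<^sub>2\<close>.\<close>
  let ?proj = "\<lambda>l x. insert_at v (l + 2) x ! l" and ?const = "\<lambda>l x. insert_at v (l + 1) x ! l"
  have "same_contiguity_class \<Omega> K (?proj l) (?const l)" if "l < n - 1" for l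
    using R that by (intro same_contiguity_class_comp[OF _ simplicial_map_nth[of l n]]) auto
  then have "same_contiguity_class \<Omega> (cat_power K (n - 1))
      (tuple_map (n - 1) ?proj) (tuple_map (n - 1) ?const)"
    using assms \<Omega>(1) by (intro same_contiguity_class_tuple) auto
  then have "same_contiguity_class \<Omega> (cat_power K (n - 1)) (\<lambda>x. x) (\<lambda>_. replicate (n - 1) v)"
  proof (rule same_contiguity_class_cong)
    fix x assume "x \<in> verts \<Omega>"
    note l = len[OF this]
    show "tuple_map (n - 1) ?proj x = x"
      using l by (intro nth_equalityI) (simp_all add: tuple_map_def insert_at_nth_before
          del: add_2_eq_Suc')
    show "tuple_map (n - 1) ?const x = replicate (n - 1) v"
      using l by (intro nth_equalityI) (simp_all add: tuple_map_def
          insert_at_nth_inserted[simplified])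
  qed
  moreover have "replicate (n - 1) v \<in> verts (cat_power K (n - 1))"
    using assms(3) by (auto simp: verts_cat_power[OF assms(1)])
  ultimately show ?cat using R by (simp add: categorical_def)
qed

theorem theorem3p3:
  fixes K :: "'a set set" and n :: nat and v0 :: 'a and w :: "'a list"
  assumes "asc K" and "n \<ge> 2" and "v0 \<in> verts K"
    and "w \<in> verts (cat_power K (n - 1))"
  shows "scat (cat_power K (n - 1)) w
       = SD (cat_power K (n - 1)) (cat_power K n) (map (insert_at v0) [1..<n + 1])"
proof -
  let ?P = "cat_power K (n - 1)"
  have "asc ?P" using assms(1,2) by (intro asc_cat_power) auto
  moreover have "replicate (n - 1) v0 \<in> verts ?P"
    using assms(3) by (auto simp: verts_cat_power[OF assms(1)])
  ultimately have "scat ?P w = scat ?P (replicate (n - 1) v0)"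
    using assms(4) by (intro scat_base_indep)
  moreover have "set (map (insert_at v0) [1..<n + 1]) = insert_at v0 ` {1..n}"
    by (simp add: atLeastLessThanSuc_atLeastAtMost del: upt_Suc)
  ultimately show ?thesis
    unfolding SD_def scat_def categorical_iff_insert_at_same_class[OF assms(1-3)]
    by (simp add: ball_conj_distrib all_conj_distrib imp_conjR conj_ac)
qed

end
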